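(* Let $A=A_1\times\cdots\times A_n$ and let $L\subseteq A^{\omega}$ be a strategical language. Let $S(L)=\{\sigma\in\Sigma\mid\gamma(\sigma)=L\}$ and let $\sigma_L=\bigcap_{\sigma\in S(L)}\sigma$, i.e. $\sigma_L(w)=\bigcap_{\sigma\in S(L)}\sigma(w)$ for all $w\in A^*$. Then $\sigma_L$ is the smallest strategy generating $L$: $\sigma_L\in\Sigma$, $\gamma(\sigma_L)=L$, and $\sigma_L\le\sigma$ for every $\sigma\in S(L)$.
   Context: $A_i$ is the set of actions of player $i$ ($1\le i\le n$) and $A=A_1\times\cdots\times A_n$ is the alphabet of moves. $A^*$ is the set of finite words on $A$ (including the empty word $\epsilon$) and $A^{\omega}$ the set of infinite words $h=h_0h_1h_2\cdots$ on $A$. A (nondeterministic) strategy for player $i$ is a relation $\sigma_i$ from $A^*$ to $A_i$, i.e. it assigns to each $w\in A^*$ a (possibly empty) subset $\sigma_i(w)\subseteq A_i$. A strategy vector on $A$ is a relation $\sigma=(\sigma_1,\dots,\sigma_n)$ from $A^*$ to $A$ of the form $(a_1,\dots,a_n)\in\sigma(w)\iff a_i\in\sigma_i(w)$ for all $1\le i\le n$. $\Sigma$ is the set of all strategy vectors on $A$ (regarded as relations from $A^*$ to $A$), and $$\gamma(\sigma)=\{h\in A^{\omega}\mid h_0\in\sigma(\epsilon)\text{ and }h_{t+1}\in\sigma(h_0\cdots h_t)\ \forall t\ge 0\}.$$ A language $L\subseteq A^{\omega}$ is strategical if $L=\gamma(\sigma)$ for some $\sigma\in\Sigma$. The order on $\Sigma$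 is $\sigma\le\sigma'\iff\sigma(w)\subseteq\sigma'(w)$ for all $w\in A^*$. *)

theory Defs
  imports Main "HOL-Library.FuncSet" "HOL-Library.Stream"
begin

text \<open>
  The action sets \<open>A 1, \<dots>, A n\<close> are subsets of one ambient type \<open>'a\<close>. A move is an
  element of the dependent product over \<open>{1..n}\<close>, so it is \<open>undefined\<close> outside that
  index set and distinct functions are distinct tuples.
\<close>

type_synonym 'a move = "nat \<Rightarrow> 'a"

definition moves :: "nat \<Rightarrow> (nat \<Rightarrow> 'a set) \<Rightarrow> 'a move set" where
  "moves n A = (\<Pi>\<^sub>E i\<in>{1..n}. A i)"

text \<open>
  Strategies are relations, i.e. sets of pairs; the paper's \<open>\<sigma>(w)\<close> is the image
  \<open>\<sigma> `` {w}\<close>, which may be empty. Requiring \<open>\<sigma> \<subseteq> lists (moves n A) \<times> _\<close> makes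
  equality of relations coincide with agreement on all words over the alphabet.
\<close>

definition player_strategies :: "nat \<Rightarrow> (nat \<Rightarrow> 'a set) \<Rightarrow> nat \<Rightarrow> ('a move list \<times> 'a) set set" where
  "player_strategies n A i = Pow (lists (moves n A) \<times> A i)"

definition strategy_vectors :: "nat \<Rightarrow> (nat \<Rightarrow> 'a set) \<Rightarrow> ('a move list \<times> 'a move) set set" where
  "strategy_vectors n A =
     {\<sigma>. \<sigma> \<subseteq> lists (moves n A) \<times> moves n A \<and>
         (\<exists>s. (\<forall>i\<in>{1..n}. s i \<in> player_strategies n A i) \<and>
              (\<forall>w\<in>lists (moves n A). \<forall>a\<in>moves n A.
                 a \<in> \<sigma> `` {w} \<longleftrightarrow> (\<forall>i\<in>{1..n}. a i \<in> s i `` {w})))}"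

definition gamma :: "nat \<Rightarrow> (nat \<Rightarrow> 'a set) \<Rightarrow> ('a move list \<times> 'a move) set \<Rightarrow> 'a move stream set" where
  "gamma n A \<sigma> =
     {h \<in> streams (moves n A).
        h !! 0 \<in> \<sigma> `` {[]} \<and> (\<forall>t. h !! Suc t \<in> \<sigma> `` {stake (Suc t) h})}"

definition strategical :: "nat \<Rightarrow> (nat \<Rightarrow> 'a set) \<Rightarrow> 'a move stream set \<Rightarrow> bool" where
  "strategical n A L \<longleftrightarrow> (\<exists>\<sigma>\<in>strategy_vectors n A. L = gamma n A \<sigma>)"

definition strategy_le ::
  "nat \<Rightarrow> (nat \<Rightarrow> 'a set) \<Rightarrow> ('a move list \<times> 'a move) set \<Rightarrow> ('a move list \<times> 'a move) set \<Rightarrow> bool" where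
  "strategy_le n A \<sigma> \<sigma>' \<longleftrightarrow> (\<forall>w\<in>lists (moves n A). \<sigma> `` {w} \<subseteq> \<sigma>' `` {w})"

definition generating_strategies ::
  "nat \<Rightarrow> (nat \<Rightarrow> 'a set) \<Rightarrow> 'a move stream set \<Rightarrow> ('a move list \<times> 'a move) set set" where
  "generating_strategies n A L = {\<sigma> \<in> strategy_vectors n A. gamma n A \<sigma> = L}"

text \<open>
  The intersection of relations has \<open>\<sigma>\<^sub>L(w) = (\<Inter>\<sigma>. \<sigma>(w))\<close> for every word \<open>w\<close>. It is
  meaningful only for strategical \<open>L\<close>, where the intersected family is nonempty.
\<close>

definition least_strategy ::
  "nat \<Rightarrow> (nat \<Rightarrow> 'a set) \<Rightarrow> 'a move stream set \<Rightarrow> ('a move list \<times> 'a move) set" where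
  "least_strategy n A L = \<Inter> (generating_strategies n A L)"

end

theory Submission
  imports Defs
begin

text \<open>Both notions involved are stable under nonempty intersections. A play belongs to
  \<open>gamma n A \<sigma>\<close> when every one of its (history, move) pairs lies in
  \<open>\<sigma>\<close>, a purely universal condition, so \<open>gamma\<close> turns intersections
  of strategies into intersections of languages (\<open>gamma_Inter\<close>). Each value of a
  strategy vector is a box, and an intersection of boxes is again a box
  (\<open>strategy_vectors_Inter\<close>). Applied to all strategies generating \<open>L\<close>, a
  family that is nonempty because \<open>L\<close> is strategical, this gives a strategy vector
  generating \<open>L\<close>; as an intersection it lies below every member.\<close>

lemma gamma_Inter:
  assumes "S \<noteq> {}"
  shows "gamma n A (\<Inter> S) = (\<Inter>\<sigma>\<in>S. gamma n A \<sigma>)"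
  using assms unfolding gamma_def by auto

lemma strategy_vectors_Inter:
  assumes "S \<noteq> {}" and "S \<subseteq> strategy_vectors n A"
  shows "\<Inter> S \<in> strategy_vectors n A"
proof -
  have "\<forall>\<sigma>\<in>S. \<exists>s. (\<forall>i\<in>{1..n}. s i \<in> player_strategies n A i) \<and>
      (\<forall>w\<in>lists (moves n A). \<forall>a\<in>moves n A.
         a \<in> \<sigma> `` {w} \<longleftrightarrow> (\<forall>i\<in>{1..n}. a i \<in> s i `` {w}))"
    using assms(2) unfolding strategy_vectors_def by blast
  \<comment> \<open>The components of a strategy vector are not unique: where one is empty, the
    others are arbitrary. Hence a choice is made for each \<open>\<sigma>\<close>.\<close>
  then obtain s where
    s_strat: "\<And>\<sigma> i. \<sigma> \<in> S \<Longrightarrow> i \<in> {1..n} \<Longrightarrow> s \<sigma> i \<in> player_strategies n A i" and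
    s_iff: "\<And>\<sigma> w a. \<sigma> \<in> S \<Longrightarrow> w \<in> lists (moves n A) \<Longrightarrow> a \<in> moves n A \<Longrightarrow>
      a \<in> \<sigma> `` {w} \<longleftrightarrow> (\<forall>i\<in>{1..n}. a i \<in> s \<sigma> i `` {w})"
    by metis
  \<comment> \<open>The sides of the intersected box: intersect player by player.\<close>
  define s' where "s' i = (\<Inter>\<sigma>\<in>S. s \<sigma> i)" for i
  have "\<Inter> S \<subseteq> lists (moves n A) \<times> moves n A"
    using assms unfolding strategy_vectors_def by blast
  \<comment> \<open>Nonemptiness of \<open>S\<close> matters: an empty intersection would be
    \<open>UNIV\<close>, not a relation on words over the alphabet.\<close>
  moreover have "\<forall>i\<in>{1..n}. s' i \<in> player_strategies n A i"
    using assms(1) s_strat unfolding s'_def player_strategies_def by blast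
  moreover have "a \<in> \<Inter> S `` {w} \<longleftrightarrow> (\<forall>i\<in>{1..n}. a i \<in> s' i `` {w})"
    if "w \<in> lists (moves n A)" "a \<in> moves n A" for w a
  proof -
    have "a \<in> \<Inter> S `` {w} \<longleftrightarrow> (\<forall>\<sigma>\<in>S. a \<in> \<sigma> `` {w})"
      by blast
    also have "\<dots> \<longleftrightarrow> (\<forall>\<sigma>\<in>S. \<forall>i\<in>{1..n}. a i \<in> s \<sigma> i `` {w})"
      using s_iff that by simp
    \<comment> \<open>The quantifiers over strategies and over players commute.\<close>
    also have "\<dots> \<longleftrightarrow> (\<forall>i\<in>{1..n}. a i \<in> s' i `` {w})"
      unfolding s'_def by blast
    finally show ?thesis .
  qed
  ultimately show ?thesis
    unfolding strategy_vectors_def by blast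
qed

theorem proposition4p1:
  fixes n :: nat
    and A :: "nat \<Rightarrow> 'a set"
    and L :: "'a move stream set"
  assumes "L \<subseteq> streams (moves n A)"
    and "strategical n A L"
  shows "least_strategy n A L \<in> strategy_vectors n A
       \<and> gamma n A (least_strategy n A L) = L
       \<and> (\<forall>\<sigma>\<in>generating_strategies n A L. strategy_le n A (least_strategy n A L) \<sigma>)"
proof (intro conjI ballI)
  have nonempty: "generating_strategies n A L \<noteq> {}"
    using assms(2) unfolding strategical_def generating_strategies_def by blast
  then show "least_strategy n A L \<in> strategy_vectors n A"
    unfolding least_strategy_def
    by (rule strategy_vectors_Inter) (auto simp: generating_strategies_def)
  have "gamma n A \<sigma> = L" if "\<sigma> \<in> generating_strategies n A L" for \<sigma>
    using that unfolding generating_strategies_def by simp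
  \<comment> \<open>By \<open>gamma_Inter\<close> this is an intersection of copies of
    \<open>L\<close> over a nonempty index set.\<close>
  with nonempty show "gamma n A (least_strategy n A L) = L"
    unfolding least_strategy_def by (simp add: gamma_Inter)
  show "strategy_le n A (least_strategy n A L) \<sigma>" if "\<sigma> \<in> generating_strategies n A L" for \<sigma>
    using that unfolding strategy_le_def least_strategy_def by blast
qed

end
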